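(* For every variable $x\in V$ and every command $c\in\mathcal C$, $$(\mathbf{var}\,x\cdot c)=(\mathbf{var}\,x\cdot c)\Cap\mathbf{guar}\,\mathrm{id}(x).$$
   Context: Commands. $(\mathcal C,\le,\bigwedge,\bigsqcup,\bot,\top)$ is a complete distributive lattice (with arbitrary meet $\bigwedge$, binary meet $\sqcap$, arbitrary join $\bigsqcup$ and binary join $\sqcup$) whose elements are called commands. It has an associative sequential composition $;$ with identity $\mathbf{nil}$, monotone in both arguments, and an associative, commutative, idempotent, monotone weak conjunction $\Cap$. Iterations: $c^\star$ (resp. $c^\omega$) is the least (resp. greatest) fixed point of $y\mapsto\mathbf{nil}\sqcup c;y$. States and relations. $V$ is a countable set of variables, $S$ a set, $\Sigma$ the set of partial functions $V\rightharpoonup S$. $\mathrm{id}(x)$ relates $\sigma,\sigma'\in\Sigma$ iff they agree on the variable $x$; $\mathrm{id}$ is the identity relation on $\Sigma$. Primitive commands. $\pi,\epsilon:\mathcal P(\Sigma\times\Sigma)\to\mathcal A$ (program and environment steps) are injective homomorphisms of complete Boolean algebras onto complete Boolean sub-algebras of $\mathcal C$, where $\mathcal A\subseteq\mathcal C$ is the complete Boolean sub-algebra of atomic steps. $\boldsymbol\pi=\pi(\Sigma\times\Sigma)$ and $\boldsymbol\epsilon=\epsilon(\Sigma\times\Sigma)$ are complementary in $\mathcal A$; $\boldsymbol\alpha=\boldsymbol\pi\sqcup\boldsymbol\epsilon$. $\mathbf{chaos}=\boldsymbol\alpha^\omega$ is the identity of $\Cap$. Localisation. For each $x\in V$ there is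 a unary operator $\mathsf E_x$ on $\mathcal C$ satisfying $c\le\mathsf E_xc$; $\mathsf E_x(c\sqcap\mathsf E_xd)=\mathsf E_xc\sqcap\mathsf E_xd$; $\mathsf E_x\mathsf E_yc=\mathsf E_y\mathsf E_xc$; $\mathsf E_x(\bigsqcup C)=\bigsqcup_{c\in C}\mathsf E_xc$; $\mathsf E_x(c\Cap\mathsf E_xd)=\mathsf E_xc\Cap\mathsf E_xd$. Derived commands. $\mathbf{guar}\,g=(\pi(g)\sqcup\boldsymbol\epsilon)^\omega$; $\mathbf{demand}\,r=(\epsilon(r)\sqcup\boldsymbol\pi)^\omega$; $\mathbf{term}=\boldsymbol\alpha^\star;\boldsymbol\epsilon^\omega$; $\mathbf{idle}=\mathbf{term}\Cap\mathbf{guar}\,\mathrm{id}$. Known properties of the algebra: $\mathbf{guar}\,g_1\Cap\mathbf{guar}\,g_2=\mathbf{guar}(g_1\cap g_2)$; $\mathbf{guar}\,g\Cap(c;d)=(\mathbf{guar}\,g\Cap c);(\mathbf{guar}\,g\Cap d)$. Local blocks. $(\mathbf{local}\,x\cdot c)=\mathsf E_x(\mathbf{demand}\,\mathrm{id}(x)\Cap c)\Cap\mathbf{guar}\,\mathrm{id}(x)$ and $(\mathbf{var}\,x\cdot c)=\mathbf{idle};(\mathbf{local}\,x\cdot c);\mathbf{idle}$. *)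

theory Defs
  imports Main "HOL-Library.Countable"
begin

unbundle lattice_syntax

(* States are the partial functions from the variables 'v to the values 's. *)
type_synonym ('v, 's) state = "'v \<rightharpoonup> 's"

definition id_on_var :: "'v \<Rightarrow> ('v, 's) state rel" where
  "id_on_var x = {(\<sigma>, \<sigma>'). \<sigma> x = \<sigma>' x}"

definition relative_complement :: "'c::complete_lattice \<Rightarrow> 'c \<Rightarrow> 'c \<Rightarrow> bool" where
  "relative_complement t a b \<longleftrightarrow> a \<sqinter> b = \<bottom> \<and> a \<squnion> b = t"

(* The greatest element of a sub-algebra is its own join and need not be the top of the
   ambient lattice: complements are taken relative to it, and only nonempty meets are
   inherited (the empty meet of the sub-algebra is its own greatest element).
   Bottom and all joins are those of the ambient lattice. *)
definition complete_boolean_subalgebra :: "'c::{complete_lattice,distrib_lattice} set \<Rightarrow> bool" where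
  "complete_boolean_subalgebra A \<longleftrightarrow>
     (\<forall>X \<subseteq> A. \<Squnion>X \<in> A) \<and>
     (\<forall>X \<subseteq> A. X \<noteq> {} \<longrightarrow> \<Sqinter>X \<in> A) \<and>
     (\<forall>a \<in> A. \<exists>b \<in> A. relative_complement (\<Squnion>A) a b)"

definition complete_boolean_embedding ::
    "('r set \<Rightarrow> 'c::{complete_lattice,distrib_lattice}) \<Rightarrow> bool" where
  "complete_boolean_embedding f \<longleftrightarrow>
     inj f \<and>
     (\<forall>R. f (\<Union>R) = \<Squnion>(f ` R)) \<and>
     (\<forall>R. R \<noteq> {} \<longrightarrow> f (\<Inter>R) = \<Sqinter>(f ` R)) \<and>
     (\<forall>r. relative_complement (f UNIV) (f r) (f (- r))) \<and>
     complete_boolean_subalgebra (range f)"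

(* The lattice structure on the commands 'c comes from type classes; refinement is \<le>,
   and \<squnion> is nondeterministic choice. *)
record ('c, 'v, 's) commands =
  seq :: "'c \<Rightarrow> 'c \<Rightarrow> 'c"  (infixl ";;\<index>" 75)
  skip :: 'c  ("nil\<index>")
  wconj :: "'c \<Rightarrow> 'c \<Rightarrow> 'c"  (infixl "\<otimes>\<index>" 70)
  atomic :: "'c set"  ("\<A>\<index>")
  pstep :: "('v, 's) state rel \<Rightarrow> 'c"  ("\<pi>\<index>")
  estep :: "('v, 's) state rel \<Rightarrow> 'c"  ("\<epsilon>\<index>")
  localise :: "'v \<Rightarrow> 'c \<Rightarrow> 'c"  ("\<E>\<index>")

definition finite_iter :: "('c::complete_lattice, 'v, 's) commands \<Rightarrow> 'c \<Rightarrow> 'c" where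
  "finite_iter K c = lfp (\<lambda>y. nil\<^bsub>K\<^esub> \<squnion> (c ;;\<^bsub>K\<^esub> y))"

definition omega_iter :: "('c::complete_lattice, 'v, 's) commands \<Rightarrow> 'c \<Rightarrow> 'c" where
  "omega_iter K c = gfp (\<lambda>y. nil\<^bsub>K\<^esub> \<squnion> (c ;;\<^bsub>K\<^esub> y))"

definition any_pstep :: "('c::complete_lattice, 'v, 's) commands \<Rightarrow> 'c" where
  "any_pstep K = \<pi>\<^bsub>K\<^esub> UNIV"

definition any_estep :: "('c::complete_lattice, 'v, 's) commands \<Rightarrow> 'c" where
  "any_estep K = \<epsilon>\<^bsub>K\<^esub> UNIV"

definition any_step :: "('c::complete_lattice, 'v, 's) commands \<Rightarrow> 'c" where
  "any_step K = any_pstep K \<squnion> any_estep K"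

definition chaos :: "('c::complete_lattice, 'v, 's) commands \<Rightarrow> 'c" where
  "chaos K = omega_iter K (any_step K)"

definition guar :: "('c::complete_lattice, 'v, 's) commands \<Rightarrow> ('v, 's) state rel \<Rightarrow> 'c" where
  "guar K g = omega_iter K (\<pi>\<^bsub>K\<^esub> g \<squnion> any_estep K)"

definition demand :: "('c::complete_lattice, 'v, 's) commands \<Rightarrow> ('v, 's) state rel \<Rightarrow> 'c" where
  "demand K r = omega_iter K (\<epsilon>\<^bsub>K\<^esub> r \<squnion> any_pstep K)"

definition terminates :: "('c::complete_lattice, 'v, 's) commands \<Rightarrow> 'c" where
  "terminates K = finite_iter K (any_step K) ;;\<^bsub>K\<^esub> omega_iter K (any_estep K)"

definition idle :: "('c::complete_lattice, 'v, 's) commands \<Rightarrow> 'c" where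
  "idle K = terminates K \<otimes>\<^bsub>K\<^esub> guar K Id"

definition local_block :: "('c::complete_lattice, 'v, 's) commands \<Rightarrow> 'v \<Rightarrow> 'c \<Rightarrow> 'c" where
  "local_block K x c =
     \<E>\<^bsub>K\<^esub> x (demand K (id_on_var x) \<otimes>\<^bsub>K\<^esub> c) \<otimes>\<^bsub>K\<^esub> guar K (id_on_var x)"

definition var_block :: "('c::complete_lattice, 'v, 's) commands \<Rightarrow> 'v \<Rightarrow> 'c \<Rightarrow> 'c" where
  "var_block K x c = idle K ;;\<^bsub>K\<^esub> local_block K x c ;;\<^bsub>K\<^esub> idle K"

locale command_algebra =
  seq: monoid "seq K" "skip K" + wconj: comm_monoid "wconj K" "chaos K"
  for K :: "('c::{complete_lattice,distrib_lattice}, 'v::countable, 's) commands" (structure) +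
  assumes seq_mono: "c \<le> c' \<Longrightarrow> d \<le> d' \<Longrightarrow> c ;; d \<le> c' ;; d'"
    and wconj_idem: "c \<otimes> c = c"
    and wconj_mono: "c \<le> c' \<Longrightarrow> d \<le> d' \<Longrightarrow> c \<otimes> d \<le> c' \<otimes> d'"
    and atomic_subalgebra: "complete_boolean_subalgebra \<A>"
    and pstep_embedding: "complete_boolean_embedding \<pi>"
    and pstep_atomic: "range \<pi> \<subseteq> \<A>"
    and estep_embedding: "complete_boolean_embedding \<epsilon>"
    and estep_atomic: "range \<epsilon> \<subseteq> \<A>"
    and pstep_estep_complementary: "relative_complement (\<Squnion>\<A>) (any_pstep K) (any_estep K)"
    and localise_ge: "c \<le> \<E> x c"
    and localise_inf: "\<E> x (c \<sqinter> \<E> x d) = \<E> x c \<sqinter> \<E> x d"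
    and localise_commute: "\<E> x (\<E> y c) = \<E> y (\<E> x c)"
    and localise_Sup: "\<E> x (\<Squnion>C) = (\<Squnion>c\<in>C. \<E> x c)"
    and localise_wconj: "\<E> x (c \<otimes> \<E> x d) = \<E> x c \<otimes> \<E> x d"
    and guar_wconj_guar: "guar K g1 \<otimes> guar K g2 = guar K (g1 \<inter> g2)"
    and guar_wconj_seq: "guar K g \<otimes> (c ;; d) = (guar K g \<otimes> c) ;; (guar K g \<otimes> d)"

end

(* Weak conjunction with a guarantee distributes over sequential composition, so it suffices
   that idle and the local block each absorb guar id(x): idle already guarantees the
   stronger relation id, and the local block has guar id(x) as a conjunct. *)
theory Submission
  imports Defs
begin

lemma Id_subset_id_on_var: "Id \<subseteq> id_on_var x"
  by (auto simp: id_on_var_def)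

context command_algebra
begin

text \<open>The conjunct \<open>guar K Id\<close> of \<open>idle K\<close> merges with
  \<open>guar K g\<close> into \<open>guar K (Id \<inter> g)\<close>, which is
  \<open>guar K Id\<close> again.\<close>

lemma idle_wconj_guar:
  assumes "Id \<subseteq> g"
  shows "idle K \<otimes> guar K g = idle K"
  using assms by (simp add: idle_def wconj.assoc guar_wconj_guar Int_absorb2)

lemma local_block_wconj_guar: "local_block K x c \<otimes> guar K (id_on_var x) = local_block K x c"
  by (simp add: local_block_def wconj.assoc wconj_idem)

text \<open>\<open>guar_wconj_seq\<close> with the guarantee moved to the right operand, where the
  absorption lemmas expect it. As a rewrite rule it carries the guarantee through both compositions
  of \<open>var_block\<close>.\<close>

lemma seq_wconj_guar: "(c ;; d) \<otimes> guar K g = (c \<otimes> guar K g) ;; (d \<otimes> guar K g)"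
  using guar_wconj_seq[of g c d] by (simp add: wconj.commute)

lemma var_block_wconj_guar: "var_block K x c \<otimes> guar K (id_on_var x) = var_block K x c"
  by (simp add: var_block_def seq_wconj_guar idle_wconj_guar Id_subset_id_on_var
      local_block_wconj_guar)

end

theorem mainTheorem7:
  fixes K :: "('c::{complete_lattice,distrib_lattice}, 'v::countable, 's) commands"
    and x :: 'v and c :: 'c
  assumes "command_algebra K"
  shows "var_block K x c = var_block K x c \<otimes>\<^bsub>K\<^esub> guar K (id_on_var x)"
  using command_algebra.var_block_wconj_guar[OF assms] by simp

end
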